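(* Let $\Gamma$ be a locally finite graph, $F$ a field with an absolute value $|\cdot|_{\rm v}$, and $\lambda\in F$. Then the following conditions are equivalent: (i) The operator $A_{\Gamma,F}-\lambda E$ is surjective. (ii) The matrix $\mathbf{A}_{\Gamma,F}-\lambda\mathbf{E}$ has in $M_{V(\Gamma)\times V(\Gamma)}(F)$ a right inverse matrix or a left inverse matrix (and hence has a right inverse matrix and a left inverse matrix that are transposes of each other). (iii) $S_{F,\lambda}(\Gamma)=\emptyset$. (iv) The operator $A_{\Gamma,F}-\lambda E$ maps the subspace $F^{V(\Gamma)*}$ of $F^{V(\Gamma)}$ injectively into itself (in other words, $A_{\Gamma,F}$ has no eigenfunctions with finite support corresponding to the eigenvalue $\lambda$). (v) $F^{V(\Gamma)*}\subseteq (A_{\Gamma,F}-\lambda E)(F^{V(\Gamma)})$.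
   Context: A graph is an undirected graph without loops or multiple edges, with vertex set $V(\Gamma)$; $\Gamma(v)$ is the set of vertices adjacent to $v$. $\Gamma$ is locally finite if every $\Gamma(v)$ is finite (it may be infinite and disconnected). $F^{V(\Gamma)}$ is the $F$-vector space of all functions $V(\Gamma)\to F$, and $A_{\Gamma,F}:F^{V(\Gamma)}\to F^{V(\Gamma)}$ is the linear operator $(A_{\Gamma,F}(f))(v)=\sum_{u\in\Gamma(v)}f(u)$; $E$ is the identity operator. The absolute value may be trivial. An eigenfunction corresponding to the eigenvalue $\lambda$ is a nonzero $f$ with $A_{\Gamma,F}(f)=\lambda f$. The support of $f$ is $\{u: f(u)\neq 0\}$; $F^{V(\Gamma)*}$ is the subspace of functions with finite support. $\delta_v$ is the function equal to $1$ at $v$ and $0$ elsewhere. An $(F,\lambda)$-propagator of $\Gamma$ with respect to $v$ is any $f\in F^{V(\Gamma)}$ with $(A_{\Gamma,F}-\lambda E)(f)=\delta_v$. $S_{F,\lambda}(\Gamma)$ is the set of vertices with respect to which $\Gamma$ has no $(F,\lambda)$-propagator. $M_{V(\Gamma)\times V(\Gamma)}(F)$ is the space of all matrices over $F$ with rows and columns indexed by $V(\Gamma)$. $\mathbf{A}_{\Gamma,F}$ is the matrix whose $(u,v)$ entry is $1$ if $u,v$ are adjacent and $0$ otherwise; $\mathbf{E}$ is the identity matrix. Since $\mathbf{A}_{\Gamma,F}-\lambda\mathbf{E}$ has finitely many nonzero entries in each row and each column, its product with any matrix of $M_{V(\Gamma)\times V(\Gamma)}(F)$, on either side, is defined; a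 right (left) inverse is a matrix $\mathbf{P}$ with $(\mathbf{A}_{\Gamma,F}-\lambda\mathbf{E})\mathbf{P}=\mathbf{E}$ (respectively $\mathbf{P}(\mathbf{A}_{\Gamma,F}-\lambda\mathbf{E})=\mathbf{E}$). *)

theory Defs
  imports Complex_Main "HOL-Library.FuncSet"
begin

definition simple_graph :: "'v set \<Rightarrow> 'v set set \<Rightarrow> bool" where
  "simple_graph V E \<longleftrightarrow> E \<subseteq> {e. e \<subseteq> V \<and> card e = 2}"

definition nbrs :: "'v set set \<Rightarrow> 'v \<Rightarrow> 'v set" where
  "nbrs E v = {u. {u, v} \<in> E}"

definition locally_finite_graph :: "'v set \<Rightarrow> 'v set set \<Rightarrow> bool" where
  "locally_finite_graph V E \<longleftrightarrow> simple_graph V E \<and> (\<forall>v\<in>V. finite (nbrs E v))"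

definition absolute_value :: "('f::field \<Rightarrow> real) \<Rightarrow> bool" where
  "absolute_value av \<longleftrightarrow>
     (\<forall>x. av x \<ge> 0) \<and> (\<forall>x. av x = 0 \<longleftrightarrow> x = 0) \<and>
     (\<forall>x y. av (x * y) = av x * av y) \<and> (\<forall>x y. av (x + y) \<le> av x + av y)"

text \<open>Functions on \<open>V\<close> are represented by functions on the whole type that are
  \<open>undefined\<close> outside \<open>V\<close>, so that equality is equality of functions on \<open>V\<close>.\<close>

definition fun_space :: "'v set \<Rightarrow> ('v \<Rightarrow> 'f::field) set" where
  "fun_space V = V \<rightarrow>\<^sub>E UNIV"

definition supp :: "'v set \<Rightarrow> ('v \<Rightarrow> 'f::field) \<Rightarrow> 'v set" where
  "supp V f = {u \<in> V. f u \<noteq> 0}"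

definition fin_fun_space :: "'v set \<Rightarrow> ('v \<Rightarrow> 'f::field) set" where
  "fin_fun_space V = {f \<in> fun_space V. finite (supp V f)}"

definition delta_fun :: "'v set \<Rightarrow> 'v \<Rightarrow> 'v \<Rightarrow> 'f::field" where
  "delta_fun V v = (\<lambda>u\<in>V. if u = v then 1 else 0)"

definition adj_op :: "'v set \<Rightarrow> 'v set set \<Rightarrow> ('v \<Rightarrow> 'f::field) \<Rightarrow> 'v \<Rightarrow> 'f" where
  "adj_op V E f = (\<lambda>v\<in>V. \<Sum>u\<in>nbrs E v. f u)"

definition scale_fun :: "'v set \<Rightarrow> 'f::field \<Rightarrow> ('v \<Rightarrow> 'f) \<Rightarrow> 'v \<Rightarrow> 'f" where
  "scale_fun V c f = (\<lambda>v\<in>V. c * f v)"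

definition shifted_op :: "'v set \<Rightarrow> 'v set set \<Rightarrow> 'f::field \<Rightarrow> ('v \<Rightarrow> 'f) \<Rightarrow> 'v \<Rightarrow> 'f" where
  "shifted_op V E l f = (\<lambda>v\<in>V. adj_op V E f v - scale_fun V l f v)"

definition eigenfunction :: "'v set \<Rightarrow> 'v set set \<Rightarrow> 'f::field \<Rightarrow> ('v \<Rightarrow> 'f) \<Rightarrow> bool" where
  "eigenfunction V E l f \<longleftrightarrow>
     f \<in> fun_space V \<and> f \<noteq> (\<lambda>v\<in>V. 0) \<and> adj_op V E f = scale_fun V l f"

definition propagator :: "'v set \<Rightarrow> 'v set set \<Rightarrow> 'f::field \<Rightarrow> 'v \<Rightarrow> ('v \<Rightarrow> 'f) \<Rightarrow> bool" where
  "propagator V E l v f \<longleftrightarrow> f \<in> fun_space V \<and> shifted_op V E l f = delta_fun V v"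

definition no_propagator_set :: "'v set \<Rightarrow> 'v set set \<Rightarrow> 'f::field \<Rightarrow> 'v set" where
  "no_propagator_set V E l = {v \<in> V. \<nexists>f. propagator V E l v f}"

definition matrices :: "'v set \<Rightarrow> ('v \<times> 'v \<Rightarrow> 'f::field) set" where
  "matrices V = V \<times> V \<rightarrow>\<^sub>E UNIV"

definition id_matrix :: "'v set \<Rightarrow> 'v \<times> 'v \<Rightarrow> 'f::field" where
  "id_matrix V = (\<lambda>(u, v) \<in> V \<times> V. if u = v then 1 else 0)"

definition adj_matrix :: "'v set \<Rightarrow> 'v set set \<Rightarrow> 'v \<times> 'v \<Rightarrow> 'f::field" where
  "adj_matrix V E = (\<lambda>(u, v) \<in> V \<times> V. if {u, v} \<in> E then 1 else 0)"

definition shifted_matrix :: "'v set \<Rightarrow> 'v set set \<Rightarrow> 'f::field \<Rightarrow> 'v \<times> 'v \<Rightarrow> 'f" where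
  "shifted_matrix V E l = (\<lambda>p \<in> V \<times> V. adj_matrix V E p - l * id_matrix V p)"

definition transpose_matrix :: "'v set \<Rightarrow> ('v \<times> 'v \<Rightarrow> 'f::field) \<Rightarrow> 'v \<times> 'v \<Rightarrow> 'f" where
  "transpose_matrix V M = (\<lambda>(u, v) \<in> V \<times> V. M (v, u))"

text \<open>Since \<open>sum\<close> is \<open>0\<close> on infinite index sets and \<open>V\<close> may be infinite, the product sums
  over the nonzero terms only.  There are finitely many of them whenever one of the factors
  is row- and column-finite, as \<open>shifted_matrix\<close> is for a locally finite graph.\<close>

definition matrix_prod ::
    "'v set \<Rightarrow> ('v \<times> 'v \<Rightarrow> 'f::field) \<Rightarrow> ('v \<times> 'v \<Rightarrow> 'f) \<Rightarrow> 'v \<times> 'v \<Rightarrow> 'f" where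
  "matrix_prod V M N = (\<lambda>(u, w) \<in> V \<times> V.
     \<Sum>x \<in> {x \<in> V. M (u, x) * N (x, w) \<noteq> 0}. M (u, x) * N (x, w))"

definition right_inverse ::
    "'v set \<Rightarrow> ('v \<times> 'v \<Rightarrow> 'f::field) \<Rightarrow> ('v \<times> 'v \<Rightarrow> 'f) \<Rightarrow> bool" where
  "right_inverse V M P \<longleftrightarrow> P \<in> matrices V \<and> matrix_prod V M P = id_matrix V"

definition left_inverse ::
    "'v set \<Rightarrow> ('v \<times> 'v \<Rightarrow> 'f::field) \<Rightarrow> ('v \<times> 'v \<Rightarrow> 'f) \<Rightarrow> bool" where
  "left_inverse V M P \<longleftrightarrow> P \<in> matrices V \<and> matrix_prod V P M = id_matrix V"

end

theory Submission
  imports Defs "HOL-Library.Function_Algebras"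
begin

text \<open>
  Write \<open>T\<close> for the operator \<open>A - l E\<close>. Its matrix is symmetric and has finite rows, so \<open>T\<close>
  acts both on all functions and on the finitely supported ones, and for the pairing
  \<open>\<langle>f, h\<rangle> = \<Sum>v. f v * h v\<close>, defined when \<open>h\<close> has finite support, one has
  \<open>\<langle>T f, h\<rangle> = \<langle>f, T h\<rangle>\<close>. The space of all functions is the full algebraic dual of the space of
  finitely supported ones, hence \<open>T\<close> on the former is the transpose of \<open>T\<close> on the latter, and
  the theorem is an instance of the principle that a linear map is injective iff its
  transpose is surjective.

  In one direction (\<open>kernel_orthogonal_range\<close>), a finitely supported \<open>h\<close> in the kernel of \<open>T\<close>
  is orthogonal to every \<open>T f\<close>, so a propagator with respect to \<open>v\<close> forces \<open>h v = 0\<close>.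
  In the other (\<open>surjective_if_injective\<close>), injectivity makes the columns \<open>T \<delta>\<^sub>v\<close> linearly
  independent, so some linear functional takes any prescribed values \<open>g v\<close> on them; the
  values of this functional on the functions \<open>\<delta>\<^sub>u\<close> form a solution \<open>f\<close> of \<open>T f = g\<close>. Such a
  functional exists because an independent family extends to a basis.

  Finally, the columns of a right inverse matrix are exactly a choice of propagators, one for
  each vertex (\<open>right_inverse_iff_columns\<close>), and since the matrix is symmetric, transposition
  exchanges its right and left inverses (\<open>left_inverse_transpose_iff\<close>).
\<close>

section \<open>Symmetric row-finite matrices\<close>

lemma sum_fun_apply: "sum f A x = (\<Sum>a\<in>A. f a x)" for f :: "'a \<Rightarrow> 'b \<Rightarrow> 'c::comm_monoid_add"
  by (induction A rule: infinite_finite_induct) simp_all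

locale symmetric_row_finite =
  fixes V :: "'v set" and K :: "'v \<Rightarrow> 'v \<Rightarrow> 'f::field"
  assumes finite_row: "v \<in> V \<Longrightarrow> finite {x \<in> V. K v x \<noteq> 0}"
    and symmetric: "u \<in> V \<Longrightarrow> v \<in> V \<Longrightarrow> K u v = K v u"
begin

definition app :: "('v \<Rightarrow> 'f) \<Rightarrow> 'v \<Rightarrow> 'f" where
  "app f v = (\<Sum>x | x \<in> V \<and> K v x \<noteq> 0. K v x * f x)"

lemma app_eq_sum:
  assumes "v \<in> V" "finite W" "W \<subseteq> V" "\<And>x. x \<in> V \<Longrightarrow> x \<notin> W \<Longrightarrow> K v x * f x = 0"
  shows "app f v = (\<Sum>x\<in>W. K v x * f x)"
proof -
  have "app f v = (\<Sum>x\<in>{x \<in> V. K v x \<noteq> 0} \<inter> W. K v x * f x)"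
    unfolding app_def using assms finite_row
    by (intro sum.mono_neutral_right) auto
  also have "\<dots> = (\<Sum>x\<in>W. K v x * f x)"
    using assms by (intro sum.mono_neutral_left) auto
  finally show ?thesis .
qed

text \<open>This is the adjointness \<open>\<langle>T f, h\<rangle> = \<langle>f, T h\<rangle> = 0\<close>. The double sum is restricted to the
  finite set of all rows meeting the support of \<open>h\<close>, so that it may be interchanged.\<close>

lemma kernel_orthogonal_range:
  assumes S: "finite S" "S \<subseteq> V" and supp: "\<And>v. v \<in> V \<Longrightarrow> v \<notin> S \<Longrightarrow> h v = 0"
    and kernel: "\<And>v. v \<in> V \<Longrightarrow> app h v = 0"
  shows "(\<Sum>v\<in>S. h v * app f v) = 0"
proof -
  define W where "W = (\<Union>v\<in>S. {x \<in> V. K v x \<noteq> 0})"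
  have W: "finite W" "W \<subseteq> V"
    using S finite_row by (auto simp: W_def)
  have "(\<Sum>v\<in>S. h v * app f v) = (\<Sum>v\<in>S. h v * (\<Sum>x\<in>W. K v x * f x))"
    using S W by (intro sum.cong refl arg_cong2[where f = "(*)"] app_eq_sum) (auto simp: W_def)
  also have "\<dots> = (\<Sum>v\<in>S. \<Sum>x\<in>W. h v * (K v x * f x))"
    by (simp add: sum_distrib_left)
  also have "\<dots> = (\<Sum>x\<in>W. \<Sum>v\<in>S. h v * (K v x * f x))"
    by (rule sum.swap)
  also have "\<dots> = (\<Sum>x\<in>W. f x * (\<Sum>v\<in>S. K x v * h v))"
    unfolding sum_distrib_left using S W symmetric
    by (intro sum.cong refl) (metis (no_types, opaque_lifting) mult.assoc mult.commute subsetD)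
  also have "\<dots> = (\<Sum>x\<in>W. f x * app h x)"
    using S W supp by (intro sum.cong refl arg_cong2[where f = "(*)"] app_eq_sum[symmetric]) auto
  also have "\<dots> = 0"
    using W kernel by (intro sum.neutral) auto
  finally show ?thesis .
qed

text \<open>A linear functional \<open>\<phi>\<close> on finitely supported functions amounts to the function
  \<open>f u = \<phi> \<delta>\<^sub>u\<close>, and by symmetry \<open>\<phi>\<close> evaluated at the column of \<open>v\<close> is \<open>app f v\<close>. So solving
  \<open>app f = g\<close> means finding a functional with prescribed values on the columns, and this is
  possible once these are linearly independent, which is what a trivial kernel says.

  The vector space in which linear independence is used is that of all functions on the
  vertex type. The columns live in it as functions vanishing outside \<open>V\<close>, so that a linear
  relation between them needs to be checked on \<open>V\<close> only.\<close>

lemma surjective_if_injective: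
  assumes inj: "\<And>h. finite {v \<in> V. h v \<noteq> 0} \<Longrightarrow> (\<And>v. v \<in> V \<Longrightarrow> app h v = 0)
      \<Longrightarrow> (\<And>v. v \<in> V \<Longrightarrow> h v = 0)"
  shows "\<exists>f. \<forall>v\<in>V. app f v = g v"
proof -
  let ?scale = "\<lambda>(c::'f) (f::'v \<Rightarrow> 'f) x. c * f x"
  interpret vector_space_pair ?scale "(*) :: 'f \<Rightarrow> 'f \<Rightarrow> 'f"
    by unfold_locales (auto simp: fun_eq_iff algebra_simps)
  define \<delta> :: "'v \<Rightarrow> 'v \<Rightarrow> 'f" where "\<delta> u = (\<lambda>x. if x = u then 1 else 0)" for u
  define col :: "'v \<Rightarrow> 'v \<Rightarrow> 'f" where "col v = (\<lambda>x. if x \<in> V then K v x else 0)" for v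
  have relation: "a v = 0"
    if S: "finite S" "S \<subseteq> V" "v \<in> S" and zero: "(\<Sum>w\<in>S. ?scale (a w) (col w)) = 0" for S a v
  proof -
    define h where "h w = (if w \<in> S then a w else 0)" for w
    have "app h x = 0" if x: "x \<in> V" for x
    proof -
      have "app h x = (\<Sum>w\<in>S. K x w * h w)"
        using S x by (intro app_eq_sum) (auto simp: h_def)
      also have "\<dots> = (\<Sum>w\<in>S. ?scale (a w) (col w)) x"
        unfolding sum_fun_apply using S x symmetric
        by (intro sum.cong) (auto simp: h_def col_def)
      finally show ?thesis
        using zero by simp
    qed
    moreover have "finite {v \<in> V. h v \<noteq> 0}"
      using S by (auto intro: rev_finite_subset simp: h_def)
    ultimately have "h v = 0"
      using inj[of h v] S by blast
    then show ?thesis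
      using S by (simp add: h_def)
  qed
  \<comment> \<open>Equal columns would satisfy a relation with coefficients 1 and -1.\<close>
  have inj_col: "inj_on col V"
  proof (rule inj_onI, rule ccontr)
    fix v w assume vw: "v \<in> V" "w \<in> V" "col v = col w" "v \<noteq> w"
    have "(\<Sum>u\<in>{v, w}. ?scale (if u = v then 1 else - 1) (col u)) = 0"
      using vw by (simp add: fun_eq_iff)
    from relation[OF _ _ _ this, of v] vw show False
      by simp
  qed
  have indep: "vs1.independent (col ` V)"
  proof
    assume "vs1.dependent (col ` V)"
    then obtain B a b where B: "finite B" "B \<subseteq> col ` V" and b: "b \<in> B" "a b \<noteq> 0"
      and zero: "(\<Sum>b\<in>B. ?scale (a b) b) = 0"
      unfolding vs1.dependent_explicit by blast
    obtain S where S: "S \<subseteq> V" "B = col ` S"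
      using B by (auto simp: subset_image_iff)
    have inj: "inj_on col S"
      using inj_col S(1) by (rule inj_on_subset)
    have "(\<Sum>w\<in>S. ?scale (a (col w)) (col w)) = 0"
      using zero S inj by (simp add: sum.reindex)
    moreover have "finite S"
      using B S inj by (simp add: finite_image_iff)
    moreover obtain v where "v \<in> S" "b = col v"
      using b S by auto
    ultimately show False
      using relation[of S v "\<lambda>w. a (col w)"] S b by simp
  qed
  obtain \<phi> where lin: "Vector_Spaces.linear ?scale (*) \<phi>"
    and \<phi>: "\<forall>c\<in>col ` V. \<phi> c = g (the_inv_into V col c)"
    using linear_independent_extend[OF indep, of "\<lambda>c. g (the_inv_into V col c)"] by blast
  have "app (\<lambda>u. \<phi> (\<delta> u)) v = g v" if v: "v \<in> V" for v
  proof -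
    have "col v = (\<Sum>x | x \<in> V \<and> K v x \<noteq> 0. ?scale (K v x) (\<delta> x))"
    proof
      fix y
      show "col v y = (\<Sum>x | x \<in> V \<and> K v x \<noteq> 0. ?scale (K v x) (\<delta> x)) y"
        using finite_row[OF v] by (simp add: sum_fun_apply col_def \<delta>_def if_distrib cong: if_cong)
    qed
    then have "\<phi> (col v) = app (\<lambda>u. \<phi> (\<delta> u)) v"
      by (simp add: app_def linear_sum[OF lin] linear_scale[OF lin])
    moreover have "\<phi> (col v) = g v"
      using \<phi> v inj_col by (simp add: the_inv_into_f_f)
    ultimately show ?thesis
      by simp
  qed
  then show ?thesis
    by blast
qed

end

section \<open>Matrix inverses\<close>

text \<open>Reversing the order of the factors does not affect which terms of the product are nonzero,
  so the identity holds even where the product is not a genuinely finite sum and takes the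
  default value 0.\<close>

lemma transpose_matrix_prod:
  "matrix_prod V (transpose_matrix V N) (transpose_matrix V M)
     = transpose_matrix V (matrix_prod V M N)"
proof (rule ext, clarify)
  fix u w
  have "{x \<in> V. transpose_matrix V N (u, x) * transpose_matrix V M (x, w) \<noteq> 0}
      = {x \<in> V. M (w, x) * N (x, u) \<noteq> 0}" if "u \<in> V" "w \<in> V"
    using that by (auto simp: transpose_matrix_def)
  then show "matrix_prod V (transpose_matrix V N) (transpose_matrix V M) (u, w)
      = transpose_matrix V (matrix_prod V M N) (u, w)"
    by (auto simp: matrix_prod_def transpose_matrix_def mult.commute intro!: sum.cong)
qed

lemma transpose_transpose_matrix:
  "P \<in> matrices V \<Longrightarrow> transpose_matrix V (transpose_matrix V P) = P"
proof (rule ext, clarify)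
  fix u v assume "P \<in> matrices V"
  then show "transpose_matrix V (transpose_matrix V P) (u, v) = P (u, v)"
    using PiE_arb[of P "V \<times> V" "\<lambda>_. UNIV" "(u, v)"]
    by (cases "u \<in> V \<and> v \<in> V") (auto simp: matrices_def transpose_matrix_def)
qed

lemma transpose_id_matrix: "transpose_matrix V (id_matrix V) = id_matrix V"
  by (rule ext) (auto simp: id_matrix_def transpose_matrix_def restrict_def)

lemma transpose_in_matrices: "transpose_matrix V P \<in> matrices V"
  by (auto simp: matrices_def transpose_matrix_def)

lemma left_inverse_transpose_iff:
  assumes "transpose_matrix V M = M" "P \<in> matrices V"
  shows "left_inverse V M (transpose_matrix V P) \<longleftrightarrow> right_inverse V M P"
proof -
  have "matrix_prod V (transpose_matrix V P) M = transpose_matrix V (matrix_prod V M P)"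
    using transpose_matrix_prod[of V P M] assms by simp
  moreover have "matrix_prod V M P \<in> matrices V"
    by (auto simp: matrix_prod_def matrices_def)
  ultimately show ?thesis
    unfolding left_inverse_def right_inverse_def
    by (metis assms(2) transpose_id_matrix transpose_in_matrices transpose_transpose_matrix)
qed

section \<open>The shifted adjacency operator of a locally finite graph\<close>

locale loc_finite_graph =
  fixes V :: "'v set" and E :: "'v set set" and l :: "'f::field"
  assumes locally_finite: "locally_finite_graph V E"
begin

lemma nbrs_subset: "nbrs E v \<subseteq> V - {v}"
  using locally_finite by (auto simp: locally_finite_graph_def simple_graph_def nbrs_def)

lemma finite_nbrs: "v \<in> V \<Longrightarrow> finite (nbrs E v)"
  using locally_finite by (simp add: locally_finite_graph_def)

definition K :: "'v \<Rightarrow> 'v \<Rightarrow> 'f" where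
  "K u v = shifted_matrix V E l (u, v)"

lemma K_eq:
  "u \<in> V \<Longrightarrow> v \<in> V \<Longrightarrow> K u v = (if v \<in> nbrs E u then 1 else 0) - l * (if u = v then 1 else 0)"
  by (simp add: K_def shifted_matrix_def adj_matrix_def id_matrix_def nbrs_def insert_commute)

sublocale symmetric_row_finite V K
proof
  fix v assume v: "v \<in> V"
  have "{x \<in> V. K v x \<noteq> 0} \<subseteq> insert v (nbrs E v)"
    using v by (auto simp: K_eq split: if_splits)
  then show "finite {x \<in> V. K v x \<noteq> 0}"
    by (rule finite_subset) (simp add: finite_nbrs v)
next
  fix u v assume "u \<in> V" "v \<in> V"
  then show "K u v = K v u"
    by (auto simp: K_eq nbrs_def insert_commute)
qed

lemma transpose_shifted_matrix:
  "transpose_matrix V (shifted_matrix V E l) = shifted_matrix V E l"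
proof
  fix p show "transpose_matrix V (shifted_matrix V E l) p = shifted_matrix V E l p"
    using symmetric unfolding K_def
    by (cases p) (auto simp: transpose_matrix_def shifted_matrix_def)
qed

lemma shifted_op_eq_app:
  assumes v: "v \<in> V"
  shows "shifted_op V E l f v = app f v"
proof -
  have notin: "v \<notin> nbrs E v"
    using nbrs_subset by blast
  have "app f v = (\<Sum>x\<in>insert v (nbrs E v). K v x * f x)"
    using v nbrs_subset by (intro app_eq_sum) (auto simp: finite_nbrs K_eq)
  also have "\<dots> = - l * f v + (\<Sum>x\<in>nbrs E v. K v x * f x)"
    using v notin by (simp add: finite_nbrs K_eq)
  also have "(\<Sum>x\<in>nbrs E v. K v x * f x) = (\<Sum>x\<in>nbrs E v. f x)"
  proof (intro sum.cong refl)
    fix x assume "x \<in> nbrs E v"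
    then have "x \<in> V" "v \<noteq> x" "x \<in> nbrs E v"
      using nbrs_subset by auto
    then show "K v x * f x = f x"
      using v by (simp add: K_eq)
  qed
  finally show ?thesis
    using v by (simp add: shifted_op_def adj_op_def scale_fun_def)
qed

lemma shifted_op_in_fun_space: "shifted_op V E l f \<in> fun_space V"
  by (simp add: fun_space_def shifted_op_def)

lemma fun_space_eqI:
  "f \<in> fun_space V \<Longrightarrow> g \<in> fun_space V \<Longrightarrow> (\<And>v. v \<in> V \<Longrightarrow> f v = g v) \<Longrightarrow> f = g"
  unfolding fun_space_def by (rule PiE_ext)

lemma zero_in_fin_fun_space: "(\<lambda>v\<in>V. 0) \<in> fin_fun_space V"
  by (simp add: fin_fun_space_def fun_space_def supp_def)

lemma delta_in_fin_fun_space: "(delta_fun V v :: 'v \<Rightarrow> 'f) \<in> fin_fun_space V"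
proof -
  have "supp V (delta_fun V v :: 'v \<Rightarrow> 'f) \<subseteq> {v}"
    by (auto simp: supp_def delta_fun_def)
  then have "finite (supp V (delta_fun V v :: 'v \<Rightarrow> 'f))"
    by (rule finite_subset) simp
  then show ?thesis
    by (simp add: fin_fun_space_def fun_space_def delta_fun_def)
qed

lemma app_restrict: "app (restrict f V) v = app f v"
  unfolding app_def by (intro sum.cong) auto

lemma app_diff: "app (\<lambda>x. f x - g x) v = app f v - app g v"
  by (simp add: app_def right_diff_distrib sum_subtractf)

lemma shifted_op_maps_fin_fun_space: "shifted_op V E l ` fin_fun_space V \<subseteq> fin_fun_space V"
proof
  fix g assume "g \<in> shifted_op V E l ` fin_fun_space V"
  then obtain f where f: "finite (supp V f)" and g: "g = shifted_op V E l f"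
    by (auto simp: fin_fun_space_def)
  have "supp V g \<subseteq> (\<Union>x\<in>supp V f. {v \<in> V. K x v \<noteq> 0})"
  proof
    fix v assume "v \<in> supp V g"
    then have v: "v \<in> V" "app f v \<noteq> 0"
      by (auto simp: supp_def g shifted_op_eq_app)
    then obtain x where "x \<in> V" "K v x \<noteq> 0" "f x \<noteq> 0"
      unfolding app_def by (auto elim: sum.not_neutral_contains_not_neutral)
    then show "v \<in> (\<Union>x\<in>supp V f. {v \<in> V. K x v \<noteq> 0})"
      using v symmetric[of v x] by (auto simp: supp_def)
  qed
  moreover have "finite (\<Union>x\<in>supp V f. {v \<in> V. K x v \<noteq> 0})"
    using f finite_row by (auto simp: supp_def)
  ultimately show "g \<in> fin_fun_space V"
    using shifted_op_in_fun_space by (auto simp: fin_fun_space_def g intro: finite_subset)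
qed

lemma inj_on_fin_fun_space_iff:
  "inj_on (shifted_op V E l) (fin_fun_space V) \<longleftrightarrow>
     (\<forall>h. finite {v \<in> V. h v \<noteq> 0} \<longrightarrow> (\<forall>v\<in>V. app h v = 0) \<longrightarrow> (\<forall>v\<in>V. h v = 0))"
    (is "?inj \<longleftrightarrow> ?ker")
proof
  assume inj: ?inj
  show ?ker
  proof (intro allI impI)
    fix h assume fin: "finite {v \<in> V. h v \<noteq> 0}" and 0: "\<forall>v\<in>V. app h v = 0"
    have "{v \<in> V. restrict h V v \<noteq> 0} = {v \<in> V. h v \<noteq> 0}"
      by auto
    then have "restrict h V \<in> fin_fun_space V"
      using fin by (simp add: fin_fun_space_def fun_space_def supp_def)
    moreover have "shifted_op V E l (restrict h V) = shifted_op V E l (\<lambda>v\<in>V. 0)"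
      using 0 by (intro fun_space_eqI shifted_op_in_fun_space)
        (simp only: shifted_op_eq_app app_restrict, simp add: app_def)
    ultimately have "restrict h V = (\<lambda>v\<in>V. 0)"
      using inj zero_in_fin_fun_space by (auto dest: inj_onD)
    then show "\<forall>v\<in>V. h v = 0"
      by (metis restrict_apply')
  qed
next
  assume ker: ?ker
  show ?inj
  proof (rule inj_onI)
    fix f g assume f: "f \<in> fin_fun_space V" and g: "g \<in> fin_fun_space V"
      and eq: "shifted_op V E l f = shifted_op V E l g"
    have "{v \<in> V. f v - g v \<noteq> 0} \<subseteq> supp V f \<union> supp V g"
      by (auto simp: supp_def)
    then have "finite {v \<in> V. f v - g v \<noteq> 0}"
      using f g by (auto simp: fin_fun_space_def intro: finite_subset)
    moreover have "app (\<lambda>x. f x - g x) v = 0" if "v \<in> V" for v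
      using fun_cong[OF eq, of v] that by (simp add: shifted_op_eq_app app_diff)
    ultimately have "\<forall>v\<in>V. f v - g v = 0"
      using ker[rule_format, of "\<lambda>x. f x - g x"] by blast
    then show "f = g"
      using f g by (intro fun_space_eqI) (auto simp: fin_fun_space_def)
  qed
qed

lemma eigenfunction_iff:
  "eigenfunction V E l f \<longleftrightarrow>
     f \<in> fun_space V \<and> (\<exists>v\<in>V. f v \<noteq> 0) \<and> (\<forall>v\<in>V. app f v = 0)"
proof -
  have "adj_op V E f = scale_fun V l f \<longleftrightarrow> (\<forall>v\<in>V. adj_op V E f v - scale_fun V l f v = 0)"
    by (auto simp: fun_eq_iff adj_op_def scale_fun_def restrict_def)
  also have "\<dots> \<longleftrightarrow> (\<forall>v\<in>V. app f v = 0)"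
    by (simp add: shifted_op_eq_app[symmetric] shifted_op_def)
  finally have "adj_op V E f = scale_fun V l f \<longleftrightarrow> (\<forall>v\<in>V. app f v = 0)" .
  moreover have "f \<noteq> (\<lambda>v\<in>V. 0) \<longleftrightarrow> (\<exists>v\<in>V. f v \<noteq> 0)" if "f \<in> fun_space V"
    using that fun_space_eqI[of f "\<lambda>v\<in>V. 0"] by (auto simp: fun_space_def)
  ultimately show ?thesis
    unfolding eigenfunction_def by blast
qed

lemma injective_iff_no_eigenfunction:
  "inj_on (shifted_op V E l) (fin_fun_space V) \<longleftrightarrow>
     \<not> (\<exists>f. eigenfunction V E l f \<and> finite (supp V f))"
proof
  assume "inj_on (shifted_op V E l) (fin_fun_space V)"
  then show "\<not> (\<exists>f. eigenfunction V E l f \<and> finite (supp V f))"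
    unfolding inj_on_fin_fun_space_iff eigenfunction_iff supp_def by blast
next
  assume no: "\<not> (\<exists>f. eigenfunction V E l f \<and> finite (supp V f))"
  show "inj_on (shifted_op V E l) (fin_fun_space V)"
    unfolding inj_on_fin_fun_space_iff
  proof (intro allI impI, rule ccontr)
    fix h assume fin: "finite {v \<in> V. h v \<noteq> 0}" and "\<forall>v\<in>V. app h v = 0" "\<not> (\<forall>v\<in>V. h v = 0)"
    then have "eigenfunction V E l (restrict h V)"
      unfolding eigenfunction_iff app_restrict by (auto simp: fun_space_def)
    moreover have "supp V (restrict h V) = {v \<in> V. h v \<noteq> 0}"
      by (auto simp: supp_def)
    ultimately show False
      using no fin by metis
  qed
qed

lemma surjective_if_injective_on_fin:
  assumes "inj_on (shifted_op V E l) (fin_fun_space V)"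
  shows "shifted_op V E l ` fun_space V = fun_space V"
proof
  show "shifted_op V E l ` fun_space V \<subseteq> fun_space V"
    using shifted_op_in_fun_space by blast
  show "fun_space V \<subseteq> shifted_op V E l ` fun_space V"
  proof
    fix g :: "'v \<Rightarrow> 'f" assume g: "g \<in> fun_space V"
    have "\<exists>f. \<forall>v\<in>V. app f v = g v"
    proof (rule surjective_if_injective)
      fix h v assume "finite {v \<in> V. h v \<noteq> 0}" "\<And>v. v \<in> V \<Longrightarrow> app h v = 0" "v \<in> V"
      then show "h v = 0"
        using assms[unfolded inj_on_fin_fun_space_iff, rule_format, of h v] by blast
    qed
    then obtain f where f: "\<forall>v\<in>V. app f v = g v" ..
    have "g = shifted_op V E l (restrict f V)"
      using f by (intro fun_space_eqI g shifted_op_in_fun_space)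
        (simp add: shifted_op_eq_app app_restrict)
    moreover have "restrict f V \<in> fun_space V"
      by (simp add: fun_space_def)
    ultimately show "g \<in> shifted_op V E l ` fun_space V"
      by (rule image_eqI)
  qed
qed

lemma propagator_iff:
  assumes "v \<in> V"
  shows "propagator V E l v f \<longleftrightarrow>
    f \<in> fun_space V \<and> (\<forall>u\<in>V. app f u = (if u = v then 1 else 0))"
proof -
  have "shifted_op V E l f = delta_fun V v \<longleftrightarrow>
      (\<forall>u\<in>V. shifted_op V E l f u = (delta_fun V v u :: 'f))"
    by (auto simp: fun_eq_iff shifted_op_def delta_fun_def restrict_def)
  then show ?thesis
    unfolding propagator_def by (simp add: shifted_op_eq_app delta_fun_def)
qed

lemma injective_if_propagators:
  assumes "no_propagator_set V E l = {}"
  shows "inj_on (shifted_op V E l) (fin_fun_space V)"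
  unfolding inj_on_fin_fun_space_iff
proof (intro allI impI ballI)
  fix h v assume fin: "finite {v \<in> V. h v \<noteq> 0}" and 0: "\<forall>v\<in>V. app h v = 0" and v: "v \<in> V"
  \<comment> \<open>Pairing \<open>h\<close> with \<open>app f\<close>, which is the delta function at \<open>v\<close>, extracts the value \<open>h v\<close>.\<close>
  obtain f where f: "\<forall>u\<in>V. app f u = (if u = v then 1 else 0)"
    using assms v propagator_iff[OF v] unfolding no_propagator_set_def by blast
  have "(\<Sum>u | u \<in> V \<and> h u \<noteq> 0. h u * app f u) = 0"
    using fin 0 by (intro kernel_orthogonal_range) auto
  moreover have "(\<Sum>u | u \<in> V \<and> h u \<noteq> 0. h u * app f u)
      = (\<Sum>u | u \<in> V \<and> h u \<noteq> 0. if u = v then h u else 0)"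
    using f by (intro sum.cong) auto
  ultimately show "h v = 0"
    using fin v by (auto split: if_splits)
qed

lemma right_inverse_iff_columns:
  "right_inverse V (shifted_matrix V E l) P \<longleftrightarrow>
     P \<in> matrices V \<and> (\<forall>w\<in>V. \<forall>u\<in>V. app (\<lambda>x. P (x, w)) u = (if u = w then 1 else 0))"
proof -
  have "matrix_prod V (shifted_matrix V E l) P (u, w) = app (\<lambda>x. P (x, w)) u"
    if "u \<in> V" "w \<in> V" for u w
    unfolding matrix_prod_def app_def K_def using that finite_row[of u]
    by (auto simp: K_def intro!: sum.mono_neutral_left)
  moreover have "matrix_prod V (shifted_matrix V E l) P = id_matrix V \<longleftrightarrow>
      (\<forall>w\<in>V. \<forall>u\<in>V. matrix_prod V (shifted_matrix V E l) P (u, w) = id_matrix V (u, w))"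
    by (auto simp: fun_eq_iff matrix_prod_def id_matrix_def restrict_def)
  ultimately show ?thesis
    unfolding right_inverse_def by (simp add: id_matrix_def)
qed

lemma right_inverse_iff_propagators:
  "(\<exists>P. right_inverse V (shifted_matrix V E l) P) \<longleftrightarrow> no_propagator_set V E l = {}"
proof
  assume "\<exists>P. right_inverse V (shifted_matrix V E l) P"
  then obtain P
    where P: "\<forall>w\<in>V. \<forall>u\<in>V. app (\<lambda>x. P (x, w)) u = (if u = w then 1 else 0)"
    unfolding right_inverse_iff_columns by blast
  have "propagator V E l w (\<lambda>x\<in>V. P (x, w))" if "w \<in> V" for w
    using P that by (simp add: propagator_iff app_restrict fun_space_def)
  then show "no_propagator_set V E l = {}"
    by (auto simp: no_propagator_set_def)
next
  assume "no_propagator_set V E l = {}"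
  then have "\<forall>w\<in>V. \<exists>f. propagator V E l w f"
    by (auto simp: no_propagator_set_def)
  then obtain p where p: "\<forall>w\<in>V. propagator V E l w (p w)"
    by metis
  define P where "P = (\<lambda>(x, w) \<in> V \<times> V. p w x)"
  have "app (\<lambda>x. P (x, w)) u = app (p w) u" if "w \<in> V" for u w
    unfolding app_def using that by (intro sum.cong) (auto simp: P_def)
  then have "right_inverse V (shifted_matrix V E l) P"
    unfolding right_inverse_iff_columns using p
    by (auto simp: propagator_iff matrices_def P_def)
  then show "\<exists>P. right_inverse V (shifted_matrix V E l) P"
    by blast
qed

lemma left_inverse_iff_right_inverse:
  "(\<exists>P. left_inverse V (shifted_matrix V E l) P) \<longleftrightarrow>
     (\<exists>P. right_inverse V (shifted_matrix V E l) P)"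
  using left_inverse_transpose_iff[OF transpose_shifted_matrix]
  by (metis left_inverse_def right_inverse_def transpose_in_matrices transpose_transpose_matrix)

end

theorem mainTheorem5:
  fixes V :: "'v set" and E :: "'v set set"
    and av :: "'f::field \<Rightarrow> real" and l :: 'f
  assumes "locally_finite_graph V E"
    and "absolute_value av"
  defines "cond_i \<equiv> shifted_op V E l ` fun_space V = fun_space V"
    and "cond_ii \<equiv> (\<exists>P. right_inverse V (shifted_matrix V E l) P) \<or>
                   (\<exists>P. left_inverse V (shifted_matrix V E l) P)"
    and "cond_ii_both \<equiv> \<exists>P Q. right_inverse V (shifted_matrix V E l) P \<and>
                   left_inverse V (shifted_matrix V E l) Q \<and> Q = transpose_matrix V P"
    and "cond_iii \<equiv> no_propagator_set V E l = {}"
    and "cond_iv \<equiv> shifted_op V E l ` fin_fun_space V \<subseteq> fin_fun_space V \<and>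
                   inj_on (shifted_op V E l) (fin_fun_space V)"
    and "cond_iv_eigen \<equiv> \<not> (\<exists>f. eigenfunction V E l f \<and> finite (supp V f))"
    and "cond_v \<equiv> fin_fun_space V \<subseteq> shifted_op V E l ` fun_space V"
  shows "(cond_i \<longleftrightarrow> cond_ii) \<and> (cond_ii \<longleftrightarrow> cond_iii) \<and> (cond_iii \<longleftrightarrow> cond_iv) \<and>
         (cond_iv \<longleftrightarrow> cond_v) \<and> (cond_ii \<longrightarrow> cond_ii_both) \<and> (cond_iv \<longleftrightarrow> cond_iv_eigen)"
proof -
  interpret loc_finite_graph V E l
    by unfold_locales (rule assms(1))
  have ii_iii: "cond_ii \<longleftrightarrow> cond_iii"
    unfolding cond_ii_def cond_iii_def
    using left_inverse_iff_right_inverse right_inverse_iff_propagators by blast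
  have iii_iv: "cond_iii \<Longrightarrow> cond_iv"
    unfolding cond_iii_def cond_iv_def
    using injective_if_propagators shifted_op_maps_fin_fun_space by blast
  have iv_i: "cond_iv \<Longrightarrow> cond_i"
    unfolding cond_iv_def cond_i_def using surjective_if_injective_on_fin by blast
  have i_v: "cond_i \<Longrightarrow> cond_v"
    unfolding cond_i_def cond_v_def by (simp add: fin_fun_space_def)
  have v_iii: cond_iii if v: cond_v
  proof -
    have "\<exists>f. propagator V E l v f" for v
      using v delta_in_fin_fun_space[of v] unfolding cond_v_def propagator_def
      by (metis imageE subsetD)
    then show ?thesis
      by (simp add: cond_iii_def no_propagator_set_def)
  qed
  have both: cond_ii_both if ii: cond_ii
  proof -
    obtain P where P: "right_inverse V (shifted_matrix V E l) P"
      using ii left_inverse_iff_right_inverse unfolding cond_ii_def by blast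
    then have "left_inverse V (shifted_matrix V E l) (transpose_matrix V P)"
      using left_inverse_transpose_iff[OF transpose_shifted_matrix]
      by (simp add: right_inverse_def)
    with P show ?thesis
      unfolding cond_ii_both_def by blast
  qed
  have eigen: "cond_iv \<longleftrightarrow> cond_iv_eigen"
    unfolding cond_iv_def cond_iv_eigen_def
    using injective_iff_no_eigenfunction shifted_op_maps_fin_fun_space by blast
  show ?thesis
    using ii_iii iii_iv iv_i i_v v_iii both eigen by blast
qed

end
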